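(* Let $t\ge 2$ be an integer, let $\ell\in\{2,3,4,5\}$, and let $G$ be the lollipop graph $L(t,\ell)$, so that $|V(G)|=n=t+\ell-1$. Let $c_i$ be the coefficient of $x^i$ in $\det(D(G)-xI)$, where $D(G)$ is the distance matrix of $G$. Then the sequence $(-1)^{n-1}c_0,\ldots,(-1)^{n-1}c_{n-2}$ is unimodal with peak at $\lfloor\frac{n-1}{2}\rfloor$.
   Context: The lollipop graph $L(t,\ell)$ is obtained from a clique $K_t$ and a path on $\ell$ vertices by identifying one end-vertex of the path with one vertex of the clique. The distance matrix $D(G)$ of a connected graph $G$ has $(u,v)$-entry equal to the length of a shortest path between $u$ and $v$. A finite real sequence $a_0,\ldots,a_N$ is unimodal with peak at $m$ if $a_{i-1}\le a_i$ for all $1\le i\le m$ and $a_i\ge a_{i+1}$ for all $m\le i\le N-1$. *)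

theory Defs
  imports
    "Graph_Theory.Graph_Theory"
    "Jordan_Normal_Form.Char_Poly"
begin

text \<open>The clique lives on \<open>0, \<dots>, t - 1\<close> and the path is \<open>t - 1, t, \<dots>, t + l - 2\<close>;
  they share exactly the vertex \<open>t - 1\<close>. As usual in this library, an undirected edge is
  a pair of opposite arcs.\<close>

definition lollipop :: "nat \<Rightarrow> nat \<Rightarrow> nat pair_pre_digraph" where
  "lollipop t l = \<lparr>
     pverts = {0..<t} \<union> {t - 1..<t + l - 1},
     parcs = {(u, v). u \<in> {0..<t} \<and> v \<in> {0..<t} \<and> u \<noteq> v}
       \<union> {(u, v). u \<in> {t - 1..<t + l - 1} \<and> v \<in> {t - 1..<t + l - 1} \<and> (v = Suc u \<or> u = Suc v)} \<rparr>"

lemma pair_graph_lollipop: "pair_graph (lollipop t l)"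
proof
  show "finite (parcs (lollipop t l))"
    by (rule finite_subset[of _ "pverts (lollipop t l) \<times> pverts (lollipop t l)"])
       (auto simp: lollipop_def)
qed (auto simp: lollipop_def symmetric_def intro!: symI)

text \<open>Distance is the shortest-path cost \<open>\<mu>\<close> for unit arc weights, which is finite between any two
  vertices of a connected graph. Rows and columns follow the increasing order of the vertices.\<close>

definition distance_matrix :: "('a :: linorder, 'b) pre_digraph \<Rightarrow> real mat" where
  "distance_matrix G = (let vs = sorted_list_of_set (verts G) in
     mat (length vs) (length vs)
       (\<lambda>(i, j). real_of_ereal (wf_digraph.\<mu> G (\<lambda>_. 1) (vs ! i) (vs ! j))))"

text \<open>\<open>det (A - x I)\<close> as a polynomial in \<open>x\<close>, whereas the library's \<^const>\<open>char_poly\<close> is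
  \<open>det (x I - A)\<close>.\<close>

definition det_minus_x :: "'a :: comm_ring_1 mat \<Rightarrow> 'a poly" where
  "det_minus_x A = det (map_mat (\<lambda>a. [:a:]) A - [:0, 1:] \<cdot>\<^sub>m 1\<^sub>m (dim_row A))"

definition unimodal_with_peak :: "(nat \<Rightarrow> 'a :: linorder) \<Rightarrow> nat \<Rightarrow> nat \<Rightarrow> bool" where
  "unimodal_with_peak a N m \<longleftrightarrow> m \<le> N
     \<and> (\<forall>i. 1 \<le> i \<and> i \<le> m \<longrightarrow> a (i - 1) \<le> a i)
     \<and> (\<forall>i. m \<le> i \<and> i < N \<longrightarrow> a i \<ge> a (i + 1))"

end

theory Submission
  imports Defs
begin

text \<open>Put \<open>N = t - 2\<close>. The \<open>N + 1\<close> clique vertices off the path are twins, and the difference of two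
  of their unit vectors is an eigenvector of the distance matrix for the eigenvalue \<open>-1\<close>. Splitting these
  off (\<open>det_twins\<close>) leaves a quotient matrix of size \<open>l + 1\<close>, whose entries are linear in \<open>N\<close>:
  \<open>det (D - x I)\<close> is \<open>(- (1 + x))\<^sup>N\<close> times its characteristic determinant.

  For \<open>l = 2, 3, 4, 5\<close> an evaluation of that determinant (\<open>det_quotient\<close>) shows that it is, up to the sign
  \<open>(-1)\<^sup>l\<close>, of the form \<open>N (1 + x)\<^sup>l - x\<^bsup>l+1\<^esup> + (\<Sum> c x\<^sup>a (1 + x)\<^sup>b)\<close>, where all \<open>c\<close> are nonnegative and
  \<open>2 a + b\<close> is always \<open>l\<close> or \<open>l - 1\<close>. This form explains the peak. Multiplied by \<open>(1 + x)\<^sup>N\<close>, a summand becomes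
  \<open>x\<^sup>a (1 + x)\<^bsup>N+b\<^esup>\<close>, a row of Pascal's triangle centred at \<open>(N + l) / 2\<close> or \<open>(N + l - 1) / 2\<close>. Every such row has
  a peak at \<open>\<lfloor>(N + l) / 2\<rfloor> = \<lfloor>(n - 1) / 2\<rfloor>\<close>, and sequences with a common peak may be added.

  The only term with a negative sign, \<open>- x\<^bsup>l+1\<^esup> (1 + x)\<^sup>N\<close>, is absorbed by \<open>N (1 + x)\<^bsup>N+l\<^esup>\<close> (\<open>peaked_core\<close>). The
  successive differences of both are ballot numbers. Neighbouring ballot numbers of a row differ at
  most by the factor \<open>N\<close> before the centre (\<open>ballot_le_next\<close>, \<open>ballot_next_le\<close>), and by the Pascal recurrence
  they grow on the way from row \<open>N\<close> to row \<open>N + l\<close>.\<close>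

section \<open>Distances in the lollipop graph\<close>

text \<open>Such an \<open>h\<close> certifies lower bounds for distances: no walk can be shorter than the change of \<open>h\<close>.\<close>

lemma (in wf_digraph) potential_diff_le_length:
  fixes h :: "'a \<Rightarrow> real"
  assumes "\<And>e. e \<in> arcs G \<Longrightarrow> \<bar>h (head G e) - h (tail G e)\<bar> \<le> 1"
    and "awalk u p v"
  shows "\<bar>h u - h v\<bar> \<le> length p"
  using assms(2)
proof (induction p arbitrary: u)
  case (Cons e p)
  then have "\<bar>h (head G e) - h v\<bar> \<le> length p" and "\<bar>h (head G e) - h u\<bar> \<le> 1"
    using assms(1) by (auto simp: awalk_Cons_iff)
  then show ?case by simp
qed (simp add: awalk_Nil_iff)

text \<open>The infimum in the definition of \<open>\<mu>\<close> is attained by any walk whose length is a lower bound for all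
  lengths.\<close>

lemma (in wf_digraph) \<mu>_unit_eqI:
  assumes "awalk u p v" and "real (length p) = d"
    and "\<And>q. awalk u q v \<Longrightarrow> d \<le> length q"
  shows "\<mu> (\<lambda>_. 1) u v = ereal d"
proof -
  have cost: "awalk_cost (\<lambda>_. 1) q = real (length q)" for q
    by (simp add: awalk_cost_def sum_list_triv)
  show ?thesis
    unfolding \<mu>_def cost using assms by (intro INF_eqI) auto
qed

text \<open>Put a vertex \<open>w\<close> on level \<open>max w (t - 2)\<close>. All clique vertices off the path then share the level
  \<open>t - 2\<close>, the path vertices occupy consecutive levels from \<open>t - 1\<close> on, and every edge changes
  the level by at most one. The distance is the difference of levels, except that two distinct
  clique vertices on the common level are adjacent.\<close>

definition lollipop_dist :: "nat \<Rightarrow> nat \<Rightarrow> nat \<Rightarrow> real" where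
  "lollipop_dist t u v =
     (if u = v then 0 else max 1 \<bar>real (max u (t - 2)) - real (max v (t - 2))\<bar>)"

lemma pverts_lollipop: "1 \<le> t \<Longrightarrow> 1 \<le> l \<Longrightarrow> pverts (lollipop t l) = {0..<t + l - 1}"
  by (auto simp: lollipop_def)

lemma \<mu>_lollipop:
  assumes "2 \<le> t" "1 \<le> l" and uv: "u < t + l - 1" "v < t + l - 1"
  shows "wf_digraph.\<mu> (with_proj (lollipop t l)) (\<lambda>_. 1) u v = ereal (lollipop_dist t u v)"
proof -
  let ?G = "lollipop t l" and ?h = "\<lambda>w. real (max w (t - 2))"
  interpret pair_graph ?G by (rule pair_graph_lollipop)
  have up: "\<exists>p. awalk u p v \<and> real (length p) = lollipop_dist t u v"
    if "u \<le> v" "v < t + l - 1" for u v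
    using that
  proof (induction v)
    case 0
    then show ?case
      using assms by (intro exI[of _ "[]"]) (auto simp: awalk_Nil_iff lollipop_dist_def pverts_lollipop)
  next
    case (Suc v)
    consider "u = Suc v" | "u \<le> v" "Suc v < t" | "u \<le> v" "t \<le> Suc v"
      using Suc.prems by linarith
    then show ?case
    proof cases
      case 1
      then show ?thesis
        using Suc.prems assms
        by (intro exI[of _ "[]"]) (auto simp: awalk_Nil_iff lollipop_dist_def pverts_lollipop)
    next
      case 2
      then have "(u, Suc v) \<in> parcs ?G" by (auto simp: lollipop_def)
      moreover have "lollipop_dist t u (Suc v) = 1"
        using 2 by (auto simp: lollipop_dist_def max_def)
      ultimately show ?thesis
        using arc_implies_awalk[of "(u, Suc v)"] by (intro exI[of _ "[(u, Suc v)]"]) simp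
    next
      case 3
      obtain p where p: "awalk u p v" "real (length p) = lollipop_dist t u v"
        using Suc.IH 3 Suc.prems by auto
      \<comment> \<open>Beyond the clique a shortest walk is extended by one edge of the path.\<close>
      have "(v, Suc v) \<in> parcs ?G"
        using 3 Suc.prems assms by (auto simp: lollipop_def)
      then have "awalk u (p @ [(v, Suc v)]) (Suc v)"
        using p(1) arc_implies_awalk[of "(v, Suc v)"] by (intro awalk_appendI) auto
      moreover have "lollipop_dist t u (Suc v) = lollipop_dist t u v + 1"
        using 3 by (auto simp: lollipop_dist_def max_def)
      ultimately show ?thesis
        using p(2) by (intro exI[of _ "p @ [(v, Suc v)]"]) simp
    qed
  qed
  have "\<exists>p. awalk u p v \<and> real (length p) = lollipop_dist t u v"
  proof (cases "u \<le> v")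
    case True
    then show ?thesis using up uv by blast
  next
    case False
    then obtain p where p: "awalk v p u" "real (length p) = lollipop_dist t v u"
      using up uv by (metis nle_le)
    have "length (rev_path p) = length p" by (induction p) auto
    moreover have "lollipop_dist t v u = lollipop_dist t u v"
      by (simp add: lollipop_dist_def abs_minus_commute)
    ultimately show ?thesis using p by (intro exI[of _ "rev_path p"]) simp
  qed
  then obtain p where p: "awalk u p v" "real (length p) = lollipop_dist t u v" by blast
  have "lollipop_dist t u v \<le> length q" if q: "awalk u q v" for q
  proof (cases "u = v")
    case False
    then have "q \<noteq> []" using q by (auto simp: awalk_Nil_iff)
    moreover have "\<bar>?h u - ?h v\<bar> \<le> length q"
      by (rule potential_diff_le_length[OF _ q]) (auto simp: lollipop_def)
    ultimately show ?thesis
      using False by (cases q) (auto simp: lollipop_dist_def)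
  qed (simp add: lollipop_dist_def)
  then show ?thesis using \<mu>_unit_eqI p by blast
qed

lemma distance_matrix_lollipop:
  assumes "2 \<le> t" "1 \<le> l"
  shows "distance_matrix (with_proj (lollipop t l)) =
    mat (t + l - 1) (t + l - 1) (\<lambda>(i, j). lollipop_dist t i j)"
proof -
  have vs: "sorted_list_of_set (verts (with_proj (lollipop t l))) = [0..<t + l - 1]"
    using assms by (simp add: pverts_lollipop)
  show ?thesis
    unfolding distance_matrix_def Let_def vs
    using assms by (intro eq_matI) (auto simp: \<mu>_lollipop)
qed

lemma det_minus_x_mat:
  "det_minus_x (mat n n (\<lambda>(i, j). f i j)) =
    det (mat n n (\<lambda>(i, j). [:f i j:] - (if i = j then [:0, 1:] else 0)))"
  unfolding det_minus_x_def by (intro arg_cong[of _ _ det] eq_matI) (auto simp: one_pCons)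

section \<open>Determinants of matrices with twin rows and columns\<close>

text \<open>The hypothesis says that, for \<open>i < N\<close>, the vector \<open>e\<^sub>i - e\<^sub>N\<close> is an eigenvector of the matrix with
  eigenvalue \<open>d\<close>. In the basis formed by these vectors and \<open>e\<^sub>N, e\<^bsub>N+1\<^esub>, \<dots>\<close> the matrix is block
  triangular, with diagonal blocks \<open>d I\<close> and the quotient matrix in which the rows of the twins
  \<open>0, \<dots>, N\<close> are added up.\<close>

lemma det_twins:
  fixes f :: "nat \<Rightarrow> nat \<Rightarrow> 'a :: idom"
  assumes "1 \<le> k"
    and twins: "\<And>r i. r < N + k \<Longrightarrow> i < N \<Longrightarrow>
      f r i - f r N = (if r = i then d else 0) - (if r = N then d else 0)"
  shows "det (mat (N + k) (N + k) (\<lambda>(i, j). f i j)) = d ^ N *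
    det (mat k k (\<lambda>(i, j). if i = 0 then \<Sum>r < Suc N. f r (N + j) else f (N + i) (N + j)))"
proof -
  let ?n = "N + k"
  let ?A = "mat ?n ?n (\<lambda>(i, j). f i j)"
  \<comment> \<open>The columns of \<open>s\<close> are the new basis, and \<open>b\<close> is the matrix in that basis.\<close>
  define s :: "nat \<Rightarrow> nat \<Rightarrow> 'a" where
    "s m j = (if m = j then 1 else 0) - (if m = N \<and> j < N then 1 else 0)" for m j
  define b where "b m j = (if j < N then if m = j then d else 0
      else if m = N then \<Sum>r < Suc N. f r j else f m j)" for m j
  let ?S = "mat ?n ?n (\<lambda>(i, j). s i j)" and ?B = "mat ?n ?n (\<lambda>(i, j). b i j)"
  have "det ?S = prod_list (diag_mat ?S)"
    by (rule det_lower_triangular[of ?n]) (auto simp: s_def)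
  also have "\<dots> = 1"
    unfolding prod_list_diag_prod by (rule prod.neutral) (auto simp: s_def)
  finally have det_S: "det ?S = 1" .
  have "?A * ?S = ?S * ?B"
  proof (rule eq_matI)
    fix r j assume "r < dim_row (?S * ?B)" "j < dim_col (?S * ?B)"
    then have rj: "r < ?n" "j < ?n" by auto
    have "(?A * ?S) $$ (r, j) = (\<Sum>m = 0..<?n. f r m * s m j)"
      using rj by (simp add: scalar_prod_def)
    also have "\<dots> = (\<Sum>m = 0..<?n. (if m = j then f r j else 0)
        - (if m = N then if j < N then f r N else 0 else 0))"
      by (rule sum.cong) (auto simp: s_def)
    also have "\<dots> = f r j - (if j < N then f r N else 0)"
      using rj assms(1) by (simp only: sum_subtractf sum.delta finite_atLeastLessThan) auto
    finally have AS: "(?A * ?S) $$ (r, j) = f r j - (if j < N then f r N else 0)" .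
    have "(?S * ?B) $$ (r, j) = (\<Sum>m = 0..<?n. s r m * b m j)"
      using rj by (simp add: scalar_prod_def)
    also have "\<dots> = (\<Sum>m = 0..<?n. (if m = r then b r j else 0)
        - (if m < N then if r = N then b m j else 0 else 0))"
      by (rule sum.cong) (auto simp: s_def)
    also have "\<dots> = b r j - (\<Sum>m = 0..<?n. if m < N then if r = N then b m j else 0 else 0)"
      using rj by (simp only: sum_subtractf sum.delta finite_atLeastLessThan) auto
    also have "(\<Sum>m = 0..<?n. if m < N then if r = N then b m j else 0 else 0)
        = (\<Sum>m < N. if r = N then b m j else 0)"
      by (rule sum.mono_neutral_cong_right) auto
    finally have SB: "(?S * ?B) $$ (r, j) = b r j - (\<Sum>m < N. if r = N then b m j else 0)" .
    show "(?A * ?S) $$ (r, j) = (?S * ?B) $$ (r, j)"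
    proof (cases "j < N")
      case True
      then have "(\<Sum>m < N. b m j) = d" by (simp add: b_def)
      then show ?thesis
        unfolding AS SB using True twins[OF rj(1) True] by (auto simp: b_def)
    next
      case False
      then have "(\<Sum>m < N. b m j) = (\<Sum>m < N. f m j)" by (simp add: b_def)
      then show ?thesis
        unfolding AS SB using False by (auto simp: b_def)
    qed
  qed auto
  then have "det ?A = det ?B"
    using det_mult[of ?A ?n ?S] det_mult[of ?S ?n ?B] det_S by simp
  also have "?B = four_block_mat (d \<cdot>\<^sub>m 1\<^sub>m N) (mat N k (\<lambda>(i, j). f i (N + j))) (0\<^sub>m k N)
      (mat k k (\<lambda>(i, j). if i = 0 then \<Sum>r < Suc N. f r (N + j) else f (N + i) (N + j)))"
    by (rule eq_matI) (auto simp: b_def)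
  also have "det \<dots> = det (d \<cdot>\<^sub>m 1\<^sub>m N) *
      det (mat k k (\<lambda>(i, j). if i = 0 then \<Sum>r < Suc N. f r (N + j) else f (N + i) (N + j)))"
    by (rule det_four_block_mat_lower_left_zero) auto
  finally show ?thesis by (simp add: det_smult)
qed

section \<open>Laplace expansion of explicit matrices\<close>

text \<open>Explicit lists of rows let the simplifier carry out the deletion of a row and a column at once,
  so that the minors in a repeated Laplace expansion stay explicit.\<close>

definition det_rows :: "'a :: comm_ring_1 list list \<Rightarrow> 'a" where
  "det_rows rs = det (mat (length rs) (length rs) (\<lambda>(i, j). rs ! i ! j))"

text \<open>A name for the summand delays the expansion of its minor: the simplifier normalises both factors
  of a product before it notices that one of them is \<open>0\<close>, whereas \<open>laplace_term_zero\<close>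
  discards the summand with its minor unexpanded.\<close>

definition laplace_term :: "'a :: comm_ring_1 list \<Rightarrow> 'a list list \<Rightarrow> nat \<Rightarrow> 'a" where
  "laplace_term r rs m = (-1) ^ m * r ! m * det_rows (map (\<lambda>s. take m s @ drop (Suc m) s) rs)"

lemma laplace_term_zero: "r ! m = 0 \<Longrightarrow> laplace_term r rs m = 0"
  by (simp add: laplace_term_def)

lemma det_rows_Nil: "det_rows [] = 1"
  by (simp add: det_rows_def)

lemma det_rows_Cons:
  assumes "\<forall>s \<in> set rs. length s = Suc (length rs)"
  shows "det_rows (r # rs) = (\<Sum>m < Suc (length rs). laplace_term r rs m)"
proof -
  let ?k = "length rs" and ?A = "mat (Suc (length rs)) (Suc (length rs)) (\<lambda>(i, j). (r # rs) ! i ! j)"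
  have "det ?A = (\<Sum>m < Suc ?k. ?A $$ (0, m) * cofactor ?A 0 m)"
    by (rule laplace_expansion_row) auto
  also have "\<dots> = (\<Sum>m < Suc ?k. laplace_term r rs m)"
  proof (rule sum.cong[OF refl])
    fix m assume m: "m \<in> {..<Suc ?k}"
    have "length (rs ! i) = Suc ?k" if "i < ?k" for i
      using assms that by simp
    then have "mat_delete ?A 0 m =
        mat ?k ?k (\<lambda>(i, j). map (\<lambda>s. take m s @ drop (Suc m) s) rs ! i ! j)"
      using m by (intro eq_matI) (auto simp: mat_delete_def nth_append min_def)
    then show "?A $$ (0, m) * cofactor ?A 0 m = laplace_term r rs m"
      using m by (simp add: cofactor_def laplace_term_def det_rows_def mult_ac)
  qed
  finally show ?thesis by (simp add: det_rows_def)
qed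

lemma det_eq_det_rows:
  "det (mat k k (\<lambda>(i, j). f i j)) = det_rows (map (\<lambda>i. map (f i) [0..<k]) [0..<k])"
  unfolding det_rows_def by (intro arg_cong[of _ _ det] eq_matI) auto

section \<open>The characteristic polynomial of the quotient matrix\<close>

text \<open>Subtracting twice the next column and adding the one after it is a unitriangular column operation.\<close>

lemma det_second_differences:
  fixes f :: "nat \<Rightarrow> nat \<Rightarrow> 'a :: idom"
  shows "det (mat k k (\<lambda>(i, j). f i j)) = det (mat k k (\<lambda>(i, j).
    if j + 2 < k then f i j - 2 * f i (j + 1) + f i (j + 2) else f i j))"
proof -
  let ?A = "mat k k (\<lambda>(i, j). f i j)"
  define R where "R = mat k k (\<lambda>(m, j). (if m = j then 1 else 0)
    + (if j + 2 < k then (if m = j + 1 then - 2 else 0) + (if m = j + 2 then 1 else 0) else 0) :: 'a)"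
  have R: "R \<in> carrier_mat k k" by (simp add: R_def)
  have "det R = prod_list (diag_mat R)"
    by (rule det_lower_triangular[OF _ R]) (auto simp: R_def)
  also have "\<dots> = 1"
    unfolding prod_list_diag_prod by (rule prod.neutral) (auto simp: R_def)
  finally have "det R = 1" .
  moreover have "?A * R = mat k k (\<lambda>(i, j).
    if j + 2 < k then f i j - 2 * f i (j + 1) + f i (j + 2) else f i j)" (is "_ = ?B")
  proof (rule eq_matI)
    fix i j assume "i < dim_row ?B" "j < dim_col ?B"
    then have ij: "i < k" "j < k" by auto
    have "(?A * R) $$ (i, j) = (\<Sum>m = 0..<k. f i m * ((if m = j then 1 else 0)
      + (if j + 2 < k then (if m = j + 1 then - 2 else 0) + (if m = j + 2 then 1 else 0) else 0)))"
      using ij by (simp add: R_def scalar_prod_def)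
    also have "\<dots> = (\<Sum>m = 0..<k. (if m = j then f i j else 0)
      + (if m = j + 1 then (if j + 2 < k then - 2 * f i (j + 1) else 0) else 0)
      + (if m = j + 2 then (if j + 2 < k then f i (j + 2) else 0) else 0))"
      by (rule sum.cong) auto
    also have "\<dots> = ?B $$ (i, j)"
      using ij by (auto simp only: sum.distrib sum.delta finite_atLeastLessThan) auto
    finally show "(?A * R) $$ (i, j) = ?B $$ (i, j)" .
  qed (auto simp: R_def)
  ultimately show ?thesis
    using det_mult[of ?A k R] R by simp
qed

text \<open>The quotient matrix of the lollipop distances, minus \<open>x\<close> on the diagonal. Index \<open>0\<close> stands for the
  class of the \<open>N + 1\<close> clique vertices off the path and \<open>i > 0\<close> for the \<open>i\<close>-th path vertex, which has
  distance \<open>i\<close> from that class. The row \<open>0\<close> collects the whole class, hence its weight \<open>N + 1\<close>.\<close>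

definition quot_entry :: "'a :: idom \<Rightarrow> 'a \<Rightarrow> nat \<Rightarrow> nat \<Rightarrow> 'a" where
  "quot_entry N x i j = (if i = 0 then if j = 0 then N else (N + 1) * of_nat j
     else of_nat (if i \<le> j then j - i else i - j)) - (if i = j then x else 0)"

text \<open>As a function of \<open>j\<close>, the distance \<open>\<bar>i - j\<bar>\<close> is linear away from \<open>j = i\<close>, so its second differences
  vanish except at the kink; those of \<open>x I\<close> occupy three diagonals. The row \<open>0\<close> is
  linear in \<open>j\<close> up to its first entry \<open>N\<close>, which survives in the corner. So all but the last two columns
  of the quotient matrix become sparse.\<close>

lemma second_differences_quot_entry:
  "quot_entry N x i j - 2 * quot_entry N x i (j + 1) + quot_entry N x i (j + 2) =
    (if i = 0 \<and> j = 0 then N else 0) + (if i = j + 1 then 2 + 2 * x else 0)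
    - (if i = j \<or> i = j + 2 then x else 0)"
proof -
  consider "i = 0" | "i = j" | "i = j + 1" | "0 < i \<and> i < j" | "j + 2 \<le> i" by linarith
  then show ?thesis
    by cases (auto simp: quot_entry_def of_nat_diff algebra_simps)
qed

lemma det_quotient_second_differences:
  "det (mat k k (\<lambda>(i, j). quot_entry N x i j)) = det (mat k k (\<lambda>(i, j).
     if j + 2 < k then (if i = 0 \<and> j = 0 then N else 0)
       + (if i = j + 1 then 2 + 2 * x else 0) - (if i = j \<or> i = j + 2 then x else 0)
     else quot_entry N x i j))"
  unfolding det_second_differences[of k "quot_entry N x"] second_differences_quot_entry ..

text \<open>A triple \<open>(c, a, b)\<close> stands for \<open>c x\<^sup>a (1 + x)\<^sup>b\<close>, which is palindromic about \<open>(2 a + b) / 2\<close>.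
  The weights are natural numbers because their being nonnegative is the point.\<close>

definition centred_combination :: "(nat \<times> nat \<times> nat) list \<Rightarrow> 'a :: comm_ring_1 \<Rightarrow> 'a" where
  "centred_combination cs x = (\<Sum>(c, a, b) \<leftarrow> cs. of_nat c * (x ^ a * (1 + x) ^ b))"

definition quotient_form :: "nat \<Rightarrow> nat \<Rightarrow> (nat \<times> nat \<times> nat) list \<Rightarrow> 'a :: comm_ring_1 \<Rightarrow> 'a" where
  "quotient_form N l cs x = of_nat N * (1 + x) ^ l - x ^ Suc l + centred_combination cs x"

text \<open>After removal of the sign and of \<open>- x\<^bsup>l+1\<^esup>\<close>, the determinant has degree at most \<open>l\<close>. Such a polynomial
  splits uniquely into a part that is palindromic about \<open>l / 2\<close> and one that is palindromic about
  \<open>(l - 1) / 2\<close>, and each part expands uniquely in the polynomials \<open>x\<^sup>a (1 + x)\<^sup>b\<close> with the same centre.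
  The lists below record this expansion, apart from the summand \<open>N (1 + x)\<^sup>l\<close>, which is kept in
  order to dominate \<open>- x\<^bsup>l+1\<^esup>\<close>. For each of these \<open>l\<close> all weights turn out nonnegative.\<close>

lemma det_quotient_2:
  "det (mat 3 3 (\<lambda>(i, j). quot_entry (of_nat N) x i j)) =
    quotient_form N 2 [(2 * N + 4, 0, 1), (N + 2, 1, 0)] x"
  unfolding quotient_form_def centred_combination_def
  unfolding det_quotient_second_differences det_eq_det_rows
  apply (simp add: upt_conv_Cons quot_entry_def)
  apply ((simp add: det_rows_Cons det_rows_Nil laplace_term_zero, simp only: laplace_term_def)+)?
  apply (simp add: det_rows_Nil algebra_simps eval_nat_numeral)
  done

lemma det_quotient_3:
  "det (mat 4 4 (\<lambda>(i, j). quot_entry (of_nat N) x i j)) =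
    - quotient_form N 3 [(4 * N + 8, 1, 1), (7 * N + 12, 0, 2), (N, 1, 0)] x"
  unfolding quotient_form_def centred_combination_def
  unfolding det_quotient_second_differences det_eq_det_rows
  apply (simp add: upt_conv_Cons quot_entry_def)
  apply ((simp add: det_rows_Cons det_rows_Nil laplace_term_zero, simp only: laplace_term_def)+)?
  apply (simp add: det_rows_Nil algebra_simps eval_nat_numeral)
  done

lemma det_quotient_4:
  "det (mat 5 5 (\<lambda>(i, j). quot_entry (of_nat N) x i j)) =
    quotient_form N 4 [(7 * N + 18, 1, 2), (3 * N + 2, 2, 0), (19 * N + 32, 0, 3), (8 * N + 6, 1, 1)] x"
  unfolding quotient_form_def centred_combination_def
  unfolding det_quotient_second_differences det_eq_det_rows
  apply (simp add: upt_conv_Cons quot_entry_def)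
  apply ((simp add: det_rows_Cons det_rows_Nil laplace_term_zero, simp only: laplace_term_def)+)?
  apply (simp add: det_rows_Nil algebra_simps eval_nat_numeral)
  done

lemma det_quotient_5:
  "det (mat 6 6 (\<lambda>(i, j). quot_entry (of_nat N) x i j)) =
    - quotient_form N 5 [(3 * N + 25, 1, 3), (15 * N + 14, 2, 1), (47 * N + 80, 0, 4),
      (36 * N + 39, 1, 2), (1, 2, 0)] x"
  unfolding quotient_form_def centred_combination_def
  unfolding det_quotient_second_differences det_eq_det_rows
  apply (simp add: upt_conv_Cons quot_entry_def)
  apply ((simp add: det_rows_Cons det_rows_Nil laplace_term_zero, simp only: laplace_term_def)+)?
  apply (simp add: det_rows_Nil algebra_simps eval_nat_numeral)
  done

lemma det_quotient:
  assumes "l \<in> {2, 3, 4, 5}"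
  obtains cs where "\<And>c a b. (c, a, b) \<in> set cs \<Longrightarrow> 2 * a + b = l \<or> Suc (2 * a + b) = l"
    and "det (mat (Suc l) (Suc l) (\<lambda>(i, j). quot_entry (of_nat N) x i j)) =
      (-1) ^ l * quotient_form N l cs x"
proof -
  consider "l = 2" | "l = 3" | "l = 4" | "l = 5" using assms by auto
  then show thesis
  proof cases
    case 1
    show thesis
      by (rule that[of "[(2 * N + 4, 0, 1), (N + 2, 1, 0)]"])
        (use 1 det_quotient_2[of N x] in auto)
  next
    case 2
    show thesis
      by (rule that[of "[(4 * N + 8, 1, 1), (7 * N + 12, 0, 2), (N, 1, 0)]"])
        (use 2 det_quotient_3[of N x] in auto)
  next
    case 3
    show thesis
      by (rule that[of "[(7 * N + 18, 1, 2), (3 * N + 2, 2, 0), (19 * N + 32, 0, 3), (8 * N + 6, 1, 1)]"])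
        (use 3 det_quotient_4[of N x] in auto)
  next
    case 4
    show thesis
      by (rule that[of "[(3 * N + 25, 1, 3), (15 * N + 14, 2, 1), (47 * N + 80, 0, 4), (36 * N + 39, 1, 2), (1, 2, 0)]"])
        (use 4 det_quotient_5[of N x] in auto)
  qed
qed

section \<open>Differences of binomial coefficients\<close>

text \<open>The coefficient of \<open>x\<^sup>k\<close> in \<open>(1 - x) (1 + x)\<^sup>M\<close>, which for \<open>2 k \<le> M\<close> is a ballot number. It measures
  how a row of Pascal's triangle rises and falls.\<close>

definition ballot :: "nat \<Rightarrow> nat \<Rightarrow> real" where
  "ballot M k = real (M choose k) - (case k of 0 \<Rightarrow> 0 | Suc j \<Rightarrow> real (M choose j))"

lemma ballot_0 [simp]: "ballot M 0 = 1"
  by (simp add: ballot_def)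

lemma ballot_Suc: "ballot M (Suc k) = real (M choose Suc k) - real (M choose k)"
  by (simp add: ballot_def)

lemma ballot_Suc_Suc: "ballot (Suc M) (Suc k) = ballot M (Suc k) + ballot M k"
  by (cases k) (simp_all add: ballot_def)

text \<open>The factor \<open>M + 1 - 2 k\<close> shows both the sign and the antisymmetry of the ballot numbers about the
  middle of the row.\<close>

lemma ballot_closed_form:
  "real (Suc M) * ballot M k = real (Suc M choose k) * (real M + 1 - 2 * real k)"
proof (cases k)
  case 0
  then show ?thesis by simp
next
  case (Suc j)
  have lower: "real (Suc M) * real (M choose j) = real k * real (Suc M choose k)"
    unfolding Suc of_nat_mult[symmetric] by (simp only: Suc_times_binomial)
  have upper: "real (Suc M) * real (M choose k) = (real M + 1 - real k) * real (Suc M choose k)"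
  proof -
    have "Suc M choose k = (M choose j) + (M choose k)"
      by (simp add: Suc)
    then have "real (Suc M choose k) = real (M choose j) + real (M choose k)"
      by simp
    then show ?thesis using lower by (simp add: algebra_simps)
  qed
  show ?thesis
    using lower upper by (simp add: Suc ballot_Suc algebra_simps)
qed

lemma ballot_nonneg:
  assumes "2 * k \<le> Suc M"
  shows "0 \<le> ballot M k"
proof -
  have "0 \<le> real (Suc M) * ballot M k"
    unfolding ballot_closed_form using assms by (intro mult_nonneg_nonneg) auto
  then show ?thesis by (simp add: zero_le_mult_iff)
qed

lemma ballot_nonpos:
  assumes "Suc M \<le> 2 * k"
  shows "ballot M k \<le> 0"
proof -
  have "real (Suc M) * ballot M k \<le> 0"
    unfolding ballot_closed_form using assms by (intro mult_nonneg_nonpos) auto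
  then show ?thesis by (simp add: mult_le_0_iff)
qed

lemma ballot_reflect:
  assumes "k + k' = Suc M"
  shows "ballot M k = - ballot M k'"
proof -
  have "Suc M choose k = Suc M choose k'"
    using binomial_symmetric[of k "Suc M"] assms by (metis diff_add_inverse le_add1)
  moreover have "real M + 1 - 2 * real k = - (real M + 1 - 2 * real k')"
    using assms by linarith
  ultimately have "real (Suc M) * ballot M k = - (real (Suc M) * ballot M k')"
    unfolding ballot_closed_form by (simp only: mult_minus_right)
  then have "real (Suc M) * ballot M k = real (Suc M) * (- ballot M k')"
    by simp
  then show ?thesis by (simp only: mult_cancel_left) simp
qed

text \<open>By the Pascal recurrence each step along the diagonal adds a ballot number that still lies in
  the left half of its row, hence is nonnegative.\<close>

lemma ballot_mono_diag:
  assumes "2 * (k + d) \<le> N + d"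
  shows "ballot N k \<le> ballot (N + d) (k + d)"
  using assms
proof (induction d)
  case (Suc d)
  then have "0 \<le> ballot (N + d) (Suc (k + d))"
    by (intro ballot_nonneg) simp
  then show ?case
    using Suc ballot_Suc_Suc[of "N + d" "k + d"] by simp
qed simp

lemma ballot_mono_left:
  assumes "2 * k \<le> Suc N"
  shows "ballot N k \<le> ballot (N + d) k"
  using assms
proof (induction d)
  case (Suc d)
  show ?case
  proof (cases k)
    case (Suc j)
    have "0 \<le> ballot (N + d) j"
      using Suc.prems Suc by (intro ballot_nonneg) simp
    then show ?thesis
      using Suc.IH Suc.prems ballot_Suc_Suc[of "N + d" j] by (simp add: Suc)
  qed simp
qed simp

lemma mult_Suc_le_cancel: "real (Suc N) * a \<le> real (Suc N) * b \<longleftrightarrow> a \<le> b"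
  by (rule mult_le_cancel_left_pos) simp

text \<open>Before the middle of a row, neighbouring ballot numbers differ at most by the factor \<open>N\<close>. A number
  is bounded by its right neighbour because the binomial coefficients increase there, and the other
  factor of the closed form, which decreases from \<open>z + 2\<close> to \<open>z \<ge> 2\<close>, satisfies \<open>z + 2 \<le> N z\<close>.\<close>

lemma ballot_le_next:
  assumes "2 * k + 3 \<le> N"
  shows "ballot N k \<le> real N * ballot N (Suc k)"
proof -
  let ?z = "real N - 1 - 2 * real k"
  have z: "2 \<le> ?z" using assms by linarith
  have "?z + 2 \<le> 2 * ?z" using z by simp
  also have "\<dots> \<le> real N * ?z"
    using z assms by (intro mult_right_mono) auto
  finally have z': "?z + 2 \<le> real N * ?z" .
  have choose: "real (Suc N choose k) \<le> real (Suc N choose Suc k)"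
    using assms by (intro of_nat_mono binomial_mono) auto
  have "real (Suc N) * ballot N k = real (Suc N choose k) * (?z + 2)"
    unfolding ballot_closed_form by simp
  also have "\<dots> \<le> real (Suc N choose Suc k) * (real N * ?z)"
    using choose z z' by (intro mult_mono) auto
  also have "\<dots> = real N * (real (Suc N) * ballot N (Suc k))"
    unfolding ballot_closed_form by simp
  also have "\<dots> = real (Suc N) * (real N * ballot N (Suc k))"
    by (simp only: mult.left_commute)
  finally show ?thesis by (simp only: mult_Suc_le_cancel)
qed

text \<open>A number is bounded by its left neighbour because one step to the right multiplies the binomial
  coefficient in the closed form at most by \<open>N\<close> and decreases the other factor.\<close>

lemma ballot_next_le:
  assumes "1 \<le> j" and "2 * j + 1 \<le> N"
  shows "ballot N (Suc j) \<le> real N * ballot N j"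
proof -
  have "real (Suc j) * real (Suc N choose Suc j) = real (Suc N - j) * real (Suc N choose j)"
    unfolding of_nat_mult[symmetric] by (metis binomial_absorb_comp binomial_absorption mult.commute)
  also have "\<dots> \<le> (real (Suc j) * real N) * real (Suc N choose j)"
  proof (intro mult_right_mono)
    have "real (Suc N - j) \<le> 1 * real N" using assms by simp
    also have "\<dots> \<le> real (Suc j) * real N" by (intro mult_right_mono) auto
    finally show "real (Suc N - j) \<le> real (Suc j) * real N" .
  qed simp
  finally have choose: "real (Suc N choose Suc j) \<le> real N * real (Suc N choose j)"
    by (simp only: mult.assoc mult_Suc_le_cancel)
  have "real (Suc N) * ballot N (Suc j) = real (Suc N choose Suc j) * (real N - 1 - 2 * real j)"
    unfolding ballot_closed_form by simp
  also have "\<dots> \<le> (real N * real (Suc N choose j)) * (real N + 1 - 2 * real j)"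
    using choose assms by (intro mult_mono) auto
  also have "\<dots> = real N * (real (Suc N) * ballot N j)"
    unfolding ballot_closed_form by simp
  also have "\<dots> = real (Suc N) * (real N * ballot N j)"
    by (simp only: mult.left_commute)
  finally show ?thesis by (simp only: mult_Suc_le_cancel)
qed

text \<open>In the combination of \<open>N (1 + x)\<^bsup>N+l\<^esup>\<close> and \<open>- x\<^bsup>l+1\<^esup> (1 + x)\<^sup>N\<close>, this compares the rise of the first term
  with that of \<open>x\<^bsup>l+1\<^esup> (1 + x)\<^sup>N\<close> at the same exponent \<open>k + l + 1\<close>, left of the centre.\<close>

lemma ballot_rise:
  assumes "2 * k + l + 2 \<le> N" and "1 \<le> l"
  shows "ballot N k \<le> real N * ballot (N + l) (Suc k + l)"
proof -
  have "ballot N k \<le> real N * ballot N (Suc k)"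
    using assms by (intro ballot_le_next) simp
  also have "\<dots> \<le> real N * ballot (N + l) (Suc k + l)"
    using assms by (intro mult_left_mono ballot_mono_diag) auto
  finally show ?thesis .
qed

text \<open>The same comparison right of the centre, after reflection of both rows about their middles, which
  turns the exponent \<open>N + l + 1 - j\<close> into the positions \<open>j\<close> and \<open>j + 1\<close>.\<close>

lemma ballot_fall:
  assumes "1 \<le> j" and "2 * j \<le> Suc (N + l)"
  shows "ballot N (Suc j) \<le> real N * ballot (N + l) j"
proof (cases "2 * j + 1 \<le> N")
  case True
  have "ballot N (Suc j) \<le> real N * ballot N j"
    using assms True by (intro ballot_next_le) auto
  also have "\<dots> \<le> real N * ballot (N + l) j"
    using True by (intro mult_left_mono ballot_mono_left) auto
  finally show ?thesis .
next
  case False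
  then have "ballot N (Suc j) \<le> 0" by (intro ballot_nonpos) simp
  also have "\<dots> \<le> real N * ballot (N + l) j"
    using assms by (intro mult_nonneg_nonneg ballot_nonneg) auto
  finally show ?thesis .
qed

section \<open>Polynomials with unimodal coefficients\<close>

abbreviation peaked :: "real poly \<Rightarrow> nat \<Rightarrow> nat \<Rightarrow> bool" where
  "peaked p \<equiv> unimodal_with_peak (coeff p)"

lemma peaked_iff_step:
  "peaked p K m \<longleftrightarrow> m \<le> K
     \<and> (\<forall>i<m. 0 \<le> coeff p (Suc i) - coeff p i)
     \<and> (\<forall>i. m \<le> i \<and> i < K \<longrightarrow> coeff p (Suc i) - coeff p i \<le> 0)"
proof -
  have "(\<forall>i. 1 \<le> i \<and> i \<le> m \<longrightarrow> coeff p (i - 1) \<le> coeff p i) \<longleftrightarrow>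
        (\<forall>i<m. coeff p i \<le> coeff p (Suc i))"
    by (metis One_nat_def Suc_le_eq Suc_pred diff_Suc_1 le_less_Suc_eq not_less_eq_eq zero_less_Suc less_eq_Suc_le)
  then show ?thesis by (auto simp: unimodal_with_peak_def)
qed

lemma peaked_add: "peaked p K m \<Longrightarrow> peaked q K m \<Longrightarrow> peaked (p + q) K m"
  by (auto simp: unimodal_with_peak_def intro: add_mono)

lemma peaked_smult: "0 \<le> a \<Longrightarrow> peaked p K m \<Longrightarrow> peaked (Polynomial.smult a p) K m"
  by (auto simp: unimodal_with_peak_def intro: mult_left_mono)

abbreviation X :: "real poly" where "X \<equiv> [:0, 1:]"

lemma coeff_X_power_mult: "coeff (X ^ a * p) i = (if i < a then 0 else coeff p (i - a))"
  using coeff_monom_mult[of 1 a p i] by (simp add: x_pow_n monom_altdef)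

lemma coeff_one_plus_X_power: "coeff ([:1, 1:] ^ M) i = real (M choose i)"
  by (cases "i \<le> M") (simp_all add: coeff_linear_poly_power coeff_eq_0 degree_linear_power)

lemma step_shifted_binomial:
  "coeff (X ^ a * (1 + X) ^ M) (Suc i) - coeff (X ^ a * (1 + X) ^ M) i =
     (if Suc i < a then 0 else ballot M (Suc i - a))"
proof -
  have one_plus_X: "1 + X = [:1, 1:]" by (simp add: one_pCons)
  show ?thesis
    unfolding coeff_X_power_mult one_plus_X coeff_one_plus_X_power
    by (auto simp: Suc_diff_le ballot_Suc not_less le_Suc_eq)
qed

text \<open>The coefficients are a row of Pascal's triangle centred at \<open>(2 a + M) / 2\<close>; the two inequalities say
  that \<open>m\<close> is within \<open>1 / 2\<close> of this centre.\<close>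

lemma peaked_shifted_binomial:
  assumes "m \<le> K" and "2 * m \<le> 2 * a + M + 1" and "2 * a + M \<le> 2 * m + 1"
  shows "peaked (X ^ a * (1 + X) ^ M) K m"
  unfolding peaked_iff_step step_shifted_binomial
  using assms by (auto intro!: ballot_nonneg ballot_nonpos)

text \<open>The subtracted row is centred \<open>l / 2 + 1\<close> to the right of the other one, so it disturbs the rise up
  to \<open>m\<close> as well as the far end of the fall. In both places the factor \<open>N\<close> outweighs it.\<close>

lemma peaked_core:
  assumes "2 \<le> l"
  shows "peaked (Polynomial.smult (real N) ((1 + X) ^ (N + l)) - X ^ (Suc l) * (1 + X) ^ N)
           (N + l - 1) ((N + l) div 2)" (is "peaked ?p ?K ?m")
proof -
  have step: "coeff ?p (Suc i) - coeff ?p i =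
      real N * ballot (N + l) (Suc i) - (if i < l then 0 else ballot N (i - l))" for i
  proof -
    have "coeff ?p (Suc i) - coeff ?p i =
        real N * (coeff (X ^ 0 * (1 + X) ^ (N + l)) (Suc i) - coeff (X ^ 0 * (1 + X) ^ (N + l)) i)
        - (coeff (X ^ (Suc l) * (1 + X) ^ N) (Suc i) - coeff (X ^ (Suc l) * (1 + X) ^ N) i)"
      by (simp add: algebra_simps)
    then show ?thesis unfolding step_shifted_binomial by simp
  qed
  have rise: "0 \<le> coeff ?p (Suc i) - coeff ?p i" if "i < ?m" for i
  proof (cases "i < l")
    case True
    then show ?thesis
      unfolding step using that by (auto intro!: mult_nonneg_nonneg ballot_nonneg)
  next
    case False
    have "ballot N (i - l) \<le> real N * ballot (N + l) (Suc (i - l) + l)"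
      using that False assms by (intro ballot_rise) auto
    then show ?thesis unfolding step using False by simp
  qed
  have fall: "coeff ?p (Suc i) - coeff ?p i \<le> 0" if "?m \<le> i" "i < ?K" for i
  proof (cases "i < l")
    case True
    then show ?thesis
      unfolding step using that by (auto intro!: mult_nonneg_nonpos ballot_nonpos)
  next
    case False
    \<comment> \<open>Both differences lie right of the centres; reflection brings them to the left halves.\<close>
    define j where "j = N + l - i"
    have "ballot (N + l) (Suc i) = - ballot (N + l) j"
      using that by (intro ballot_reflect) (auto simp: j_def)
    moreover have "ballot N (i - l) = - ballot N (Suc j)"
      using that False by (intro ballot_reflect) (auto simp: j_def)
    moreover have "ballot N (Suc j) \<le> real N * ballot (N + l) j"
      using that by (intro ballot_fall) (auto simp: j_def)
    ultimately show ?thesis unfolding step using False by simp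
  qed
  show ?thesis unfolding peaked_iff_step using rise fall assms by auto
qed

lemma peaked_shifted_combination:
  assumes "m \<le> K"
    and "\<And>c a b. (c, a, b) \<in> set cs \<Longrightarrow> 2 * m \<le> 2 * a + b + N + 1 \<and> 2 * a + b + N \<le> 2 * m + 1"
  shows "peaked ((1 + X) ^ N * centred_combination cs X) K m"
  using assms(2)
proof (induction cs)
  case Nil
  show ?case using assms(1) by (simp add: centred_combination_def unimodal_with_peak_def)
next
  case (Cons e cs)
  obtain c a b where e: "e = (c, a, b)" by (cases e)
  have "(1 + X) ^ N * centred_combination (e # cs) X =
      Polynomial.smult (real c) (X ^ a * (1 + X) ^ (b + N)) + (1 + X) ^ N * centred_combination cs X"
    by (simp add: e centred_combination_def algebra_simps power_add of_nat_poly)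
  moreover have "peaked (X ^ a * (1 + X) ^ (b + N)) K m"
    using Cons.prems[of c a b] assms(1) by (intro peaked_shifted_binomial) (auto simp: e)
  ultimately show ?case
    using Cons by (simp only:) (intro peaked_add peaked_smult; auto)
qed

text \<open>Multiplication by \<open>(1 + x)\<^sup>N\<close> moves the centres \<open>l / 2\<close> and \<open>(l - 1) / 2\<close> to \<open>(N + l) / 2\<close> and
  \<open>(N + l - 1) / 2\<close>, and \<open>(N + l) div 2\<close> is within \<open>1 / 2\<close> of both, whatever the parity of \<open>N + l\<close>.\<close>

lemma peaked_quotient_form:
  assumes "2 \<le> l"
    and "\<And>c a b. (c, a, b) \<in> set cs \<Longrightarrow> 2 * a + b = l \<or> Suc (2 * a + b) = l"
  shows "peaked ((1 + X) ^ N * quotient_form N l cs X) (N + l - 1) ((N + l) div 2)"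
proof -
  have "(1 + X) ^ N * quotient_form N l cs X =
      (Polynomial.smult (real N) ((1 + X) ^ (N + l)) - X ^ Suc l * (1 + X) ^ N)
      + (1 + X) ^ N * centred_combination cs X"
    by (simp add: quotient_form_def algebra_simps power_add of_nat_poly)
  moreover have "peaked ((1 + X) ^ N * centred_combination cs X) (N + l - 1) ((N + l) div 2)"
    using assms by (intro peaked_shifted_combination) force+
  ultimately show ?thesis
    using peaked_core[OF assms(1), of N] by (simp only: peaked_add)
qed

section \<open>Unimodality for lollipop graphs\<close>

text \<open>The \<open>N + 1\<close> clique vertices off the path are twins: they have the same distances to all other
  vertices and distance \<open>1\<close> from each other, which gives the eigenvalue \<open>-1\<close> of the distance matrix.\<close>

lemma det_minus_x_lollipop:
  assumes "1 \<le> l"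
  shows "det_minus_x (distance_matrix (with_proj (lollipop (N + 2) l))) =
    (- (1 + X)) ^ N * det (mat (Suc l) (Suc l) (\<lambda>(i, j). quot_entry (of_nat N) X i j))"
proof -
  define f where "f i j = [:lollipop_dist (N + 2) i j:] - (if i = j then X else 0)" for i j
  have dim: "N + 2 + l - 1 = N + Suc l" by simp
  have "det_minus_x (distance_matrix (with_proj (lollipop (N + 2) l))) =
      det (mat (N + Suc l) (N + Suc l) (\<lambda>(i, j). f i j))"
    using assms by (simp only: distance_matrix_lollipop dim det_minus_x_mat f_def le_add2)
  also have "\<dots> = (- (1 + X)) ^ N * det (mat (Suc l) (Suc l)
      (\<lambda>(i, j). if i = 0 then \<Sum>r < Suc N. f r (N + j) else f (N + i) (N + j)))"
    by (rule det_twins) (auto simp: f_def lollipop_dist_def one_pCons)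
  also have "mat (Suc l) (Suc l)
        (\<lambda>(i, j). if i = 0 then \<Sum>r < Suc N. f r (N + j) else f (N + i) (N + j)) =
      mat (Suc l) (Suc l) (\<lambda>(i, j). quot_entry (of_nat N) X i j)"
  proof (intro cong_mat refl, clarsimp simp del: sum.lessThan_Suc, intro conjI impI)
    fix j
    show "(\<Sum>r < Suc N. f r (N + j)) = quot_entry (of_nat N) X 0 j"
    proof (cases "j = 0")
      case True
      then show ?thesis
        by (simp add: f_def lollipop_dist_def quot_entry_def of_nat_poly)
    next
      case False
      \<comment> \<open>All twins have the same distance \<open>j\<close> from the \<open>j\<close>-th path vertex.\<close>
      have "(\<Sum>r < Suc N. f r (N + j)) = (\<Sum>r < Suc N. of_nat j)"
        using False by (intro sum.cong) (auto simp: f_def lollipop_dist_def of_nat_poly max_def)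
      then show ?thesis using False by (simp add: quot_entry_def algebra_simps)
    qed
  next
    fix i j :: nat assume "0 < i"
    then show "f (N + i) (N + j) = quot_entry (of_nat N) X i j"
      by (auto simp: f_def lollipop_dist_def quot_entry_def of_nat_poly max_def of_nat_diff)
  qed
  finally show ?thesis .
qed

theorem corollary4p8:
  fixes t l n :: nat and G :: "nat pair_pre_digraph" and c :: "nat \<Rightarrow> real"
  assumes "t \<ge> 2" and "l \<in> {2, 3, 4, 5}"
    and "G = lollipop t l"
    and "n = card (verts G)"
    and "\<And>i. c i = coeff (det_minus_x (distance_matrix G)) i"
  shows "n = t + l - 1 \<and>
    unimodal_with_peak (\<lambda>i. (-1) ^ (n - 1) * c i) (n - 2) ((n - 1) div 2)"
proof -
  obtain N where t: "t = N + 2" using assms(1) by (metis add.commute le_Suc_ex)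
  have l: "2 \<le> l" using assms(2) by auto
  have n: "n = N + l + 1"
    using assms(3,4) t l by (simp add: pverts_lollipop)
  obtain cs where cs: "\<And>c a b. (c, a, b) \<in> set cs \<Longrightarrow> 2 * a + b = l \<or> Suc (2 * a + b) = l"
    and det: "det (mat (Suc l) (Suc l) (\<lambda>(i, j). quot_entry (of_nat N) X i j)) =
      (-1) ^ l * quotient_form N l cs X"
    using det_quotient[OF assms(2)] by metis
  have "det_minus_x (distance_matrix G) =
      (- (1 + X)) ^ N * ((-1) ^ l * quotient_form N l cs X)"
    unfolding assms(3) t det[symmetric] using l by (intro det_minus_x_lollipop) simp
  also have "\<dots> = (-1) ^ (N + l) * ((1 + X) ^ N * quotient_form N l cs X)"
    unfolding power_minus[of "1 + X"] power_add by (simp only: mult_ac)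
  finally have "(-1) ^ (N + l) * c i = coeff ((1 + X) ^ N * quotient_form N l cs X) i" for i
    by (cases "even (N + l)") (simp_all add: assms(5))
  then show ?thesis
    using peaked_quotient_form[OF l, of cs N] cs by (simp add: n t)
qed

end
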